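(* A stochastic process $X=(X_t)_{t\in[0,\infty)}$ on $(\Omega,\mathcal F,\mathsf P)$ is adapted to the filtration $(\mathcal F_t)_{t\in[0,\infty)}$ if and only if for each $t\ge 0$ there is an $\mathcal H$-measurable random variable $F(t)$ such that $X_t=F(t)$ on the set $\{t<\gamma\}$.
   Context: $(\Omega,\mathcal F,\mathsf P)$ is a probability space, $\mathcal H\subset\mathcal F$ is a sub-$\sigma$-algebra, and $\gamma$ is a random variable with values in $[0,\infty]$ such that $\mathsf P(\gamma>0)=1$. For $t\in[0,\infty)$, $\mathcal F_t$ is the collection of all $A\in\mathcal F$ for which there exists $C\in\mathcal H$ with $A\cap\{t<\gamma\}=C\cap\{t<\gamma\}$; $(\mathcal F_t)_{t\ge 0}$ is a right-continuous filtration. Standing assumption: this filtration contains all $\mathsf P$-null sets of $\mathcal F$ (so it satisfies the usual conditions). *)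

theory Defs
  imports "HOL-Probability.Probability"
begin

definition single_jump_sets ::
  "'a measure \<Rightarrow> 'a measure \<Rightarrow> ('a \<Rightarrow> ennreal) \<Rightarrow> real \<Rightarrow> 'a set set" where
  "single_jump_sets M H \<gamma> t =
     {A \<in> sets M. \<exists>C\<in>sets H.
        A \<inter> {\<omega> \<in> space M. ennreal t < \<gamma> \<omega>} = C \<inter> {\<omega> \<in> space M. ennreal t < \<gamma> \<omega>}}"

text \<open>
  The time index is a real number, with only \<open>t \<ge> 0\<close> meaningful. The collection
  \<open>single_jump_sets M H \<gamma> t\<close> is already a \<open>\<sigma>\<close>-algebra, so that applying \<open>sigma\<close> only packs
  it into the type of measures and adds no sets (lemma \<open>sets_single_jump_filtration\<close>).
\<close>

definition single_jump_filtration ::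
  "'a measure \<Rightarrow> 'a measure \<Rightarrow> ('a \<Rightarrow> ennreal) \<Rightarrow> real \<Rightarrow> 'a measure" where
  "single_jump_filtration M H \<gamma> t = sigma (space M) (single_jump_sets M H \<gamma> t)"

definition stochastic_process :: "'a measure \<Rightarrow> (real \<Rightarrow> 'a \<Rightarrow> real) \<Rightarrow> bool" where
  "stochastic_process M X \<longleftrightarrow> (\<forall>t\<ge>0. X t \<in> borel_measurable M)"

definition adapted :: "(real \<Rightarrow> 'a measure) \<Rightarrow> (real \<Rightarrow> 'a \<Rightarrow> real) \<Rightarrow> bool" where
  "adapted F X \<longleftrightarrow> (\<forall>t\<ge>0. X t \<in> borel_measurable (F t))"

lemma sigma_algebra_single_jump_sets:
  assumes H: "subalgebra M H"
  shows "sigma_algebra (space M) (single_jump_sets M H \<gamma> t)"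
proof -
  define G where "G = {\<omega> \<in> space M. ennreal t < \<gamma> \<omega>}"
  have eq: "single_jump_sets M H \<gamma> t = {A \<in> sets M. \<exists>C\<in>sets H. A \<inter> G = C \<inter> G}"
    by (simp add: single_jump_sets_def G_def)
  have G: "G \<subseteq> space M" by (auto simp: G_def)
  have spH: "space M \<in> sets H"
    using H sets.top[of H] by (simp add: subalgebra_def)
  show ?thesis
    unfolding eq sigma_algebra_iff2
  proof (intro conjI allI impI ballI)
    show "{A \<in> sets M. \<exists>C\<in>sets H. A \<inter> G = C \<inter> G} \<subseteq> Pow (space M)"
      by (auto dest: sets.sets_into_space)
    show "{} \<in> {A \<in> sets M. \<exists>C\<in>sets H. A \<inter> G = C \<inter> G}"
      by auto
  next
    fix A assume "A \<in> {A \<in> sets M. \<exists>C\<in>sets H. A \<inter> G = C \<inter> G}"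
    then obtain C where C: "A \<in> sets M" "C \<in> sets H" "A \<inter> G = C \<inter> G" by blast
    have "(space M - A) \<inter> G = (space M - C) \<inter> G" using C(3) by blast
    moreover have "space M - C \<in> sets H" using spH C(2) by blast
    ultimately show "space M - A \<in> {A \<in> sets M. \<exists>C\<in>sets H. A \<inter> G = C \<inter> G}"
      using C(1) by blast
  next
    fix A :: "nat \<Rightarrow> 'a set"
    assume "range A \<subseteq> {A \<in> sets M. \<exists>C\<in>sets H. A \<inter> G = C \<inter> G}"
    then have A: "A n \<in> sets M" "\<exists>C. C \<in> sets H \<and> A n \<inter> G = C \<inter> G" for n by blast+
    from A(2) obtain C where C: "C n \<in> sets H" "A n \<inter> G = C n \<inter> G" for n by metis
    have "(\<Union>n. A n) \<inter> G = (\<Union>n. C n) \<inter> G" using C(2) by blast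
    moreover have "(\<Union>n. C n) \<in> sets H" "(\<Union>n. A n) \<in> sets M" using C(1) A(1) by blast+
    ultimately show "\<Union> (range A) \<in> {A \<in> sets M. \<exists>C\<in>sets H. A \<inter> G = C \<inter> G}" by blast
  qed
qed

lemma space_single_jump_filtration:
  "space (single_jump_filtration M H \<gamma> t) = space M"
  unfolding single_jump_filtration_def
  by (intro space_measure_of) (auto simp: single_jump_sets_def dest: sets.sets_into_space)

lemma sets_single_jump_filtration:
  assumes "subalgebra M H"
  shows "sets (single_jump_filtration M H \<gamma> t) = single_jump_sets M H \<gamma> t"
  unfolding single_jump_filtration_def
  using sigma_algebra.sets_measure_of_eq[OF sigma_algebra_single_jump_sets[OF assms]] by simp

lemma filtration_single_jump_filtration:
  assumes H: "subalgebra M H"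
  shows "filtration (space M) (single_jump_filtration M H \<gamma>)"
proof
  show "space (single_jump_filtration M H \<gamma> t) = space M" for t
    by (rule space_single_jump_filtration)
next
  fix s t :: real assume "s \<le> t"
  then have sub: "ennreal s < \<gamma> \<omega>" if "ennreal t < \<gamma> \<omega>" for \<omega>
    using that ennreal_leI le_less_trans by blast
  show "sets (single_jump_filtration M H \<gamma> s) \<le> sets (single_jump_filtration M H \<gamma> t)"
    unfolding sets_single_jump_filtration[OF H]
  proof
    fix A assume "A \<in> single_jump_sets M H \<gamma> s"
    then obtain C where C: "A \<in> sets M" "C \<in> sets H"
      "A \<inter> {\<omega> \<in> space M. ennreal s < \<gamma> \<omega>} = C \<inter> {\<omega> \<in> space M. ennreal s < \<gamma> \<omega>}"
      unfolding single_jump_sets_def by blast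
    have "A \<inter> {\<omega> \<in> space M. ennreal t < \<gamma> \<omega>} = C \<inter> {\<omega> \<in> space M. ennreal t < \<gamma> \<omega>}"
      using C(3) sub by blast
    then show "A \<in> single_jump_sets M H \<gamma> t"
      using C(1,2) unfolding single_jump_sets_def by blast
  qed
qed

lemma right_continuous_single_jump_filtration:
  assumes H: "subalgebra M H" and t: "t \<ge> 0"
  shows "sets (single_jump_filtration M H \<gamma> t) = (\<Inter>s\<in>{t<..}. sets (single_jump_filtration M H \<gamma> s))"
proof
  show "sets (single_jump_filtration M H \<gamma> t) \<subseteq> (\<Inter>s\<in>{t<..}. sets (single_jump_filtration M H \<gamma> s))"
    using filtration.sets_F_mono[OF filtration_single_jump_filtration[OF H]]
    by (intro INT_greatest) (auto intro: less_imp_le)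
next
  show "(\<Inter>s\<in>{t<..}. sets (single_jump_filtration M H \<gamma> s)) \<subseteq> sets (single_jump_filtration M H \<gamma> t)"
    unfolding sets_single_jump_filtration[OF H]
  proof
    fix A assume A: "A \<in> (\<Inter>s\<in>{t<..}. single_jump_sets M H \<gamma> s)"
    define s where "s n = t + inverse (real (Suc n))" for n
    have s: "s n > t" for n by (simp add: s_def)
    then have As: "A \<in> single_jump_sets M H \<gamma> (s n)" for n using A by blast
    then have AM: "A \<in> sets M" by (auto simp: single_jump_sets_def)
    have "\<exists>C. C \<in> sets H \<and>
        A \<inter> {\<omega> \<in> space M. ennreal (s n) < \<gamma> \<omega>} = C \<inter> {\<omega> \<in> space M. ennreal (s n) < \<gamma> \<omega>}" for n
      using As[of n] unfolding single_jump_sets_def by blast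
    then obtain C where C: "C n \<in> sets H"
      "A \<inter> {\<omega> \<in> space M. ennreal (s n) < \<gamma> \<omega>} = C n \<inter> {\<omega> \<in> space M. ennreal (s n) < \<gamma> \<omega>}" for n
      by metis
    define D where "D = (\<Union>n. \<Inter>m\<in>{n..}. C m)"
    have DH: "D \<in> sets H" unfolding D_def using C(1) by (intro sets.countable_UN sets.countable_INT') auto
    have "\<omega> \<in> A \<longleftrightarrow> \<omega> \<in> D" if w: "\<omega> \<in> space M" "ennreal t < \<gamma> \<omega>" for \<omega>
    proof -
      have "(\<lambda>n. ennreal (s n)) \<longlonglongrightarrow> ennreal t"
        unfolding s_def using LIMSEQ_inverse_real_of_nat_add[of t] by (intro tendsto_ennrealI)
      then have "eventually (\<lambda>n. ennreal (s n) < \<gamma> \<omega>) sequentially"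
        using w(2) by (rule order_tendstoD)
      then obtain N where N: "\<And>n. n \<ge> N \<Longrightarrow> ennreal (s n) < \<gamma> \<omega>"
        by (auto simp: eventually_sequentially)
      then have eq: "\<omega> \<in> C n \<longleftrightarrow> \<omega> \<in> A" if "n \<ge> N" for n
        using C(2)[of n] w(1) that by blast
      have "\<omega> \<in> D \<Longrightarrow> \<omega> \<in> A"
      proof -
        assume "\<omega> \<in> D"
        then obtain n where "\<And>m. m \<ge> n \<Longrightarrow> \<omega> \<in> C m" by (auto simp: D_def)
        then have "\<omega> \<in> C (max n N)" by simp
        then show "\<omega> \<in> A" using eq[of "max n N"] by simp
      qed
      moreover have "\<omega> \<in> A \<Longrightarrow> \<omega> \<in> D" using eq by (auto simp: D_def)
      ultimately show ?thesis by blast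
    qed
    then have "A \<inter> {\<omega> \<in> space M. ennreal t < \<gamma> \<omega>} = D \<inter> {\<omega> \<in> space M. ennreal t < \<gamma> \<omega>}" by blast
    then show "A \<in> single_jump_sets M H \<gamma> t"
      using AM DH unfolding single_jump_sets_def by blast
  qed
qed

end

theory Submission
  imports Defs
begin

text \<open>
  Write \<open>G = {t < \<gamma>}\<close>. A set belongs to the \<open>\<sigma>\<close>-algebra at time \<open>t\<close> iff it lies in \<open>sets M\<close>
  and its trace on \<open>G\<close> is the trace of a set of \<open>H\<close>. Passing to preimages, a function is
  measurable at time \<open>t\<close> iff it is measurable for \<open>M\<close> and its restriction to \<open>G\<close> is measurable
  for the trace of \<open>H\<close> on \<open>G\<close> (lemma \<open>measurable_single_jump_filtration_iff\<close>). The theorem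
  thus reduces to the fact that the real functions measurable for the trace on \<open>G\<close> are exactly the
  restrictions to \<open>G\<close> of functions measurable for \<open>H\<close>
  (lemma \<open>borel_measurable_restrict_space_iff_extends\<close>).

  The difficulty lies in extending from \<open>G\<close>: since \<open>G\<close> need not belong to \<open>H\<close>, extension by zero
  need not be measurable for \<open>H\<close>. Instead, each sublevel set at a rational level is extended to a set of \<open>H\<close>, and
  a function is rebuilt from these countably many sets.
\<close>

text \<open>
  The infimum of the rational levels \<open>q\<close> with \<open>f \<omega> \<le> q\<close> is \<open>f \<omega>\<close>. Replacing each condition
  \<open>f \<omega> \<le> q\<close> by membership in a measurable set with the same trace on \<open>G\<close> changes nothing on \<open>G\<close>
  and turns the infimum into a function that is measurable on the whole space. A point off
  \<open>G\<close> may lie in none of the chosen sets, or in those of arbitrarily low level; the infimum is then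
  infinite, so it is formed in the extended reals and its infinite values are sent to \<open>0\<close> afterwards.
\<close>

lemma borel_measurable_restrict_space_extend:
  fixes f :: "'a \<Rightarrow> real"
  assumes f: "f \<in> borel_measurable (restrict_space N G)"
  obtains F where "F \<in> borel_measurable N" and "\<And>\<omega>. \<omega> \<in> G \<inter> space N \<Longrightarrow> f \<omega> = F \<omega>"
proof -
  have "\<exists>C\<in>sets N. \<forall>\<omega>\<in>G \<inter> space N. f \<omega> \<le> of_rat q \<longleftrightarrow> \<omega> \<in> C" for q :: rat
  proof -
    have "{\<omega> \<in> space (restrict_space N G). f \<omega> \<le> of_rat q} \<in> sets (restrict_space N G)"
      using f by measurable
    then obtain C where "C \<in> sets N" "{\<omega> \<in> G \<inter> space N. f \<omega> \<le> of_rat q} = G \<inter> C"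
      by (auto simp: sets_restrict_space space_restrict_space)
    then show ?thesis by blast
  qed
  then obtain C where C [measurable]: "\<And>q. C q \<in> sets N"
    and C_iff: "\<And>q \<omega>. \<omega> \<in> G \<inter> space N \<Longrightarrow> f \<omega> \<le> of_rat q \<longleftrightarrow> \<omega> \<in> C q"
    by metis
  define E where "E \<omega> = (INF q. if \<omega> \<in> C q then ereal (of_rat q) else \<infinity>)" for \<omega>
  have [measurable]: "E \<in> borel_measurable N"
    unfolding E_def by measurable
  have E_eq: "E \<omega> = ereal (f \<omega>)" if \<omega>: "\<omega> \<in> G \<inter> space N" for \<omega>
  proof (rule antisym)
    show "ereal (f \<omega>) \<le> E \<omega>"
      unfolding E_def
    proof (rule INF_greatest)
      show "ereal (f \<omega>) \<le> (if \<omega> \<in> C q then ereal (of_rat q) else \<infinity>)" for q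
        using C_iff[OF \<omega>, of q] by (cases "\<omega> \<in> C q") simp_all
    qed
    show "E \<omega> \<le> ereal (f \<omega>)"
    proof (rule ereal_le_epsilon2)
      fix e :: real
      assume "e > 0"
      then obtain q :: rat where q: "f \<omega> < of_rat q" "of_rat q < f \<omega> + e"
        using of_rat_dense[of "f \<omega>" "f \<omega> + e"] by auto
      then have "\<omega> \<in> C q"
        using C_iff[OF \<omega>, of q] by simp
      have "E \<omega> \<le> (if \<omega> \<in> C q then ereal (of_rat q) else \<infinity>)"
        unfolding E_def by (rule INF_lower) simp
      also have "\<dots> \<le> ereal (f \<omega>) + ereal e"
        using \<open>\<omega> \<in> C q\<close> q by simp
      finally show "E \<omega> \<le> ereal (f \<omega>) + ereal e" .
    qed
  qed
  show thesis
  proof (rule that[of "\<lambda>\<omega>. real_of_ereal (E \<omega>)"])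
    show "(\<lambda>\<omega>. real_of_ereal (E \<omega>)) \<in> borel_measurable N" by measurable
  qed (simp add: E_eq)
qed

lemma borel_measurable_restrict_space_iff_extends:
  fixes f :: "'a \<Rightarrow> real"
  shows "f \<in> borel_measurable (restrict_space N G) \<longleftrightarrow>
    (\<exists>F\<in>borel_measurable N. \<forall>\<omega>\<in>G \<inter> space N. f \<omega> = F \<omega>)"
proof
  assume "f \<in> borel_measurable (restrict_space N G)"
  then show "\<exists>F\<in>borel_measurable N. \<forall>\<omega>\<in>G \<inter> space N. f \<omega> = F \<omega>"
    by (rule borel_measurable_restrict_space_extend) blast
next
  assume "\<exists>F\<in>borel_measurable N. \<forall>\<omega>\<in>G \<inter> space N. f \<omega> = F \<omega>"
  then obtain F where F: "F \<in> borel_measurable N" "\<forall>\<omega>\<in>G \<inter> space N. f \<omega> = F \<omega>" by blast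
  have "F \<in> borel_measurable (restrict_space N G)"
    using F(1) by (rule measurable_restrict_space1)
  then show "f \<in> borel_measurable (restrict_space N G)"
    using F(2) by (subst measurable_cong[of _ f F]) (auto simp: space_restrict_space)
qed

text \<open>
  Membership in the \<open>\<sigma>\<close>-algebra at time \<open>t\<close> constrains a set of \<open>M\<close> only through its trace on
  \<open>{t < \<gamma>}\<close>, and taking preimages commutes with taking traces.
\<close>

lemma measurable_single_jump_filtration_iff:
  assumes H: "subalgebra M H"
  shows "f \<in> measurable (single_jump_filtration M H \<gamma> t) N \<longleftrightarrow>
    f \<in> measurable M N \<and>
    f \<in> measurable (restrict_space H {\<omega> \<in> space M. ennreal t < \<gamma> \<omega>}) N"
proof -
  define G where "G = {\<omega> \<in> space M. ennreal t < \<gamma> \<omega>}"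
  have sp: "space (restrict_space H G) = G"
    using H by (auto simp: G_def space_restrict_space subalgebra_def)
  have mem: "f -` A \<inter> space M \<in> single_jump_sets M H \<gamma> t \<longleftrightarrow>
      f -` A \<inter> space M \<in> sets M \<and> f -` A \<inter> G \<in> sets (restrict_space H G)" for A
  proof -
    have "f -` A \<inter> space M \<inter> G = f -` A \<inter> G" by (auto simp: G_def)
    then show ?thesis
      by (auto simp: single_jump_sets_def G_def[symmetric] sets_restrict_space image_iff Int_commute)
  qed
  have "f \<in> measurable (single_jump_filtration M H \<gamma> t) N \<longleftrightarrow>
      f \<in> measurable M N \<and> f \<in> measurable (restrict_space H G) N"
  proof -
    have "f \<in> G \<rightarrow> space N" if "f \<in> space M \<rightarrow> space N"
      using that by (auto simp: G_def)
    then show ?thesis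
      unfolding measurable_def mem_Collect_eq sp space_single_jump_filtration
        sets_single_jump_filtration[OF H] mem
      by blast
  qed
  then show ?thesis unfolding G_def .
qed

theorem proposition2p2:
  fixes M H :: "'a measure" and \<gamma> :: "'a \<Rightarrow> ennreal" and X :: "real \<Rightarrow> 'a \<Rightarrow> real"
  assumes "prob_space M"
    and "subalgebra M H"
    and "\<gamma> \<in> borel_measurable M"
    and "measure M {\<omega> \<in> space M. \<gamma> \<omega> > 0} = 1"
    and "\<forall>t\<ge>0. null_sets M \<subseteq> sets (single_jump_filtration M H \<gamma> t)"
    and "stochastic_process M X"
  shows "adapted (single_jump_filtration M H \<gamma>) X \<longleftrightarrow>
    (\<forall>t\<ge>0. \<exists>F \<in> borel_measurable H. \<forall>\<omega>\<in>space M. ennreal t < \<gamma> \<omega> \<longrightarrow> X t \<omega> = F \<omega>)"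
proof -
  have space_H: "space H = space M"
    using assms(2) by (simp add: subalgebra_def)
  have "X t \<in> borel_measurable (single_jump_filtration M H \<gamma> t) \<longleftrightarrow>
      (\<exists>F \<in> borel_measurable H. \<forall>\<omega>\<in>space M. ennreal t < \<gamma> \<omega> \<longrightarrow> X t \<omega> = F \<omega>)"
    if "t \<ge> 0" for t
  proof -
    have "X t \<in> borel_measurable M"
      using assms(6) that by (simp add: stochastic_process_def)
    then show ?thesis
      unfolding measurable_single_jump_filtration_iff[OF assms(2)]
        borel_measurable_restrict_space_iff_extends space_H
      by auto
  qed
  then show ?thesis by (simp add: adapted_def)
qed

end
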